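(* Let $M\subset N$ be finite sets, $k\in[0,\log|N|]$, $\varepsilon>0$, and let $\{f_1,\dots,f_{|D|}\}$ be functions from $N$ to $M$ that form a strong $(k,\varepsilon)$ Rényi 2-extractor. Then $\{f_1,\dots,f_{|D|}\}$ is a strong $(k,\varepsilon)$ Rényi 2-extractor against quantum side information.
   Context: Logarithms are base 2; all Hilbert spaces are finite-dimensional. $D=\{1,\dots,|D|\}$, and a classical system is identified with operators diagonal in a fixed orthonormal basis. Strong $(k,\varepsilon)$ Rényi 2-extractor: for every non-negative function $P_N$ on $N$ with $H_2(N)_P\ge k$, $$H_2(MD)_Q\ge\log\left(\frac{|M|\cdot|D|}{\varepsilon+1}\right),\qquad Q_{MD}=\frac1{|D|}\sum_{i=1}^{|D|}P_{f_i(N)}\otimes|i\rangle\langle i|_D,$$ where $P_{f_i(N)}(m)=\sum_{n:f_i(n)=m}P_N(n)$ and $H_2(N)_P=-\log\sum_{n}P_N(n)^2$ (similarly for $Q$). Strong $(k,\varepsilon)$ Rényi 2-extractor against quantum side information: for every Hilbert space $\mathcal H_R$ and every classical-quantum positive semi-definite operator $\rho_{NR}=\sum_n|n\rangle\langle n|\otimes\rho_R^n$ with $H_2(N|R)_\rho\ge k$, $$H_2(MD|R)_\sigma\ge\log\left(\frac{|M|\cdot|D|}{\varepsilon+1}\right),\qquad \sigma_{MDR}=\frac1{|D|}\sum_{i=1}^{|D|}\rho_{f_i(N)R}\otimes|i\rangle\langle i|_D,$$ where $\rho_{f_i(N)R}=\sum_{m}|m\rangle\langle m|\otimes\sum_{n:f_i(n)=m}\rho_R^n$.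 Conditional Rényi 2-entropy: $H_2(A|B)_\rho=-\log\mathrm{tr}\left[\rho_{AB}(1_A\otimes\rho_B)^{-1/2}\rho_{AB}(1_A\otimes\rho_B)^{-1/2}\right]$ for positive semi-definite $\rho_{AB}$, with generalized inverses. *)

theory Defs
  imports
    "Jordan_Normal_Form.Schur_Decomposition"
    "HOL-Library.Complex_Order"
    "HOL-Library.Extended_Real"
    "HOL-Library.Countable_Set"
begin

text \<open>Entropies take extended real values, so that the zero function and the zero operator
  have entropy \<open>\<infinity>\<close>, whereas the library has \<open>log 2 0 = 0\<close>.\<close>

definition elog2 :: "real \<Rightarrow> ereal" where
  "elog2 x = (if x > 0 then ereal (log 2 x) else -\<infinity>)"


subsection \<open>Operators on finite-dimensional Hilbert spaces\<close>

definition mat_trace :: "complex mat \<Rightarrow> complex" where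
  "mat_trace A = (\<Sum>i<dim_row A. A $$ (i, i))"

text \<open>In the order on the complex numbers, \<open>0 \<le> z\<close> means that \<open>z\<close> is real and non-negative;
  the condition below therefore makes \<open>A\<close> Hermitian.\<close>

definition psd :: "complex mat \<Rightarrow> bool" where
  "psd A \<longleftrightarrow> square_mat A \<and> (\<forall>v \<in> carrier_vec (dim_row A). 0 \<le> (A *\<^sub>v v) \<bullet>c v)"

definition psd_sqrt :: "complex mat \<Rightarrow> complex mat" where
  "psd_sqrt A = (THE B. psd B \<and> B * B = A)"

text \<open>The generalized inverse is the Moore-Penrose inverse. For a positive semi-definite operator
  it inverts the non-zero eigenvalues and vanishes on the kernel.\<close>

definition pseudo_inverse :: "complex mat \<Rightarrow> complex mat" where
  "pseudo_inverse A = (THE X. X \<in> carrier_mat (dim_col A) (dim_row A) \<and>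
     A * X * A = A \<and> X * A * X = X \<and>
     mat_adjoint (A * X) = A * X \<and> mat_adjoint (X * A) = X * A)"

definition psd_inv_sqrt :: "complex mat \<Rightarrow> complex mat" where
  "psd_inv_sqrt A = pseudo_inverse (psd_sqrt A)"

definition kron :: "complex mat \<Rightarrow> complex mat \<Rightarrow> complex mat" where
  "kron A B = mat (dim_row A * dim_row B) (dim_col A * dim_col B)
     (\<lambda>(i, j). A $$ (i div dim_row B, j div dim_col B) * B $$ (i mod dim_row B, j mod dim_col B))"

text \<open>Partial trace over the first factor of \<open>\<complex>\<^sup>a \<otimes> \<complex>\<^sup>b\<close>, in the index convention of \<open>kron\<close>.\<close>

definition ptrace1 :: "nat \<Rightarrow> nat \<Rightarrow> complex mat \<Rightarrow> complex mat" where
  "ptrace1 a b A = mat b b (\<lambda>(i, j). \<Sum>x<a. A $$ (x * b + i, x * b + j))"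

text \<open>Sum of a family of \<open>d \<times> d\<close> matrices over a finite set.\<close>

definition msum :: "nat \<Rightarrow> ('x \<Rightarrow> complex mat) \<Rightarrow> 'x set \<Rightarrow> complex mat" where
  "msum d F S = mat d d (\<lambda>(i, j). \<Sum>x\<in>S. F x $$ (i, j))"

text \<open>\<open>H\<^sub>2(A|B)\<^sub>\<rho>\<close> for an operator \<open>\<rho>\<close> on \<open>\<complex>\<^sup>a \<otimes> \<complex>\<^sup>b\<close>. The trace is real and non-negative when
  \<open>\<rho>\<close> is positive semi-definite, so taking the real part loses nothing.\<close>

definition cond_renyi2 :: "nat \<Rightarrow> nat \<Rightarrow> complex mat \<Rightarrow> ereal" where
  "cond_renyi2 a b \<rho> =
     (let T = psd_inv_sqrt (kron (1\<^sub>m a) (ptrace1 a b \<rho>))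
      in - elog2 (Re (mat_trace (\<rho> * T * \<rho> * T))))"


subsection \<open>Classical systems and classical-quantum operators\<close>

text \<open>The classical system with finite alphabet \<open>S\<close> is the space \<open>\<complex>\<^bsup>card S\<^esup>\<close>, whose standard
  basis is labelled by \<open>S\<close> through the bijection \<open>to_nat_on S\<close> onto \<open>{..<card S}\<close>.\<close>

definition basis_proj :: "'x set \<Rightarrow> 'x \<Rightarrow> complex mat" where
  "basis_proj S x = mat (card S) (card S)
     (\<lambda>(i, j). if i = to_nat_on S x \<and> j = to_nat_on S x then 1 else 0)"

text \<open>\<open>\<Sum>x\<in>S. |x\<rangle>\<langle>x| \<otimes> \<rho> x\<close>, where \<open>\<rho> x\<close> acts on \<open>\<complex>\<^sup>d\<close>.\<close>

definition cq_op :: "'x set \<Rightarrow> nat \<Rightarrow> ('x \<Rightarrow> complex mat) \<Rightarrow> complex mat" where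
  "cq_op S d \<rho> = msum (card S * d) (\<lambda>x. kron (basis_proj S x) (\<rho> x)) S"

definition renyi2 :: "'x set \<Rightarrow> ('x \<Rightarrow> real) \<Rightarrow> ereal" where
  "renyi2 S P = - elog2 (\<Sum>x\<in>S. (P x)\<^sup>2)"


subsection \<open>Extractors\<close>

text \<open>The seed set \<open>{1, \<dots>, |D|}\<close> is \<open>{1..D}\<close>. The classical system \<open>MD\<close> has alphabet
  \<open>M \<times> {1..D}\<close>, with \<open>|(m, i)\<rangle>\<langle>(m, i)|\<close> standing for \<open>|m\<rangle>\<langle>m| \<otimes> |i\<rangle>\<langle>i|\<close>. Neither \<open>P\<close> nor \<open>\<rho>\<close> is
  assumed to be normalized.\<close>

definition ext_output :: "'a set \<Rightarrow> nat \<Rightarrow> (nat \<Rightarrow> 'a \<Rightarrow> 'b) \<Rightarrow> ('a \<Rightarrow> real) \<Rightarrow> 'b \<times> nat \<Rightarrow> real" where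
  "ext_output N D f P = (\<lambda>(m, i). 1 / real D * (\<Sum>n | n \<in> N \<and> f i n = m. P n))"

definition strong_renyi2_extractor ::
  "'a set \<Rightarrow> 'b set \<Rightarrow> nat \<Rightarrow> (nat \<Rightarrow> 'a \<Rightarrow> 'b) \<Rightarrow> real \<Rightarrow> real \<Rightarrow> bool" where
  "strong_renyi2_extractor N M D f k \<epsilon> \<longleftrightarrow>
     (\<forall>P. (\<forall>n\<in>N. 0 \<le> P n) \<longrightarrow> renyi2 N P \<ge> ereal k \<longrightarrow>
        renyi2 (M \<times> {1..D}) (ext_output N D f P)
          \<ge> ereal (log 2 (real (card M) * real D / (\<epsilon> + 1))))"

text \<open>The block of \<open>\<sigma>\<^sub>M\<^sub>D\<^sub>R\<close> at \<open>|m\<rangle>\<langle>m| \<otimes> |i\<rangle>\<langle>i|\<close>.\<close>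

definition ext_output_qsi ::
  "'a set \<Rightarrow> nat \<Rightarrow> (nat \<Rightarrow> 'a \<Rightarrow> 'b) \<Rightarrow> nat \<Rightarrow> ('a \<Rightarrow> complex mat) \<Rightarrow> 'b \<times> nat \<Rightarrow> complex mat" where
  "ext_output_qsi N D f d \<rho> =
     (\<lambda>(m, i). (1 / of_nat D) \<cdot>\<^sub>m msum d \<rho> {n \<in> N. f i n = m})"

text \<open>The Hilbert space of \<open>R\<close> is \<open>\<complex>\<^sup>d\<close> with \<open>d\<close> arbitrary.\<close>

definition strong_renyi2_extractor_qsi ::
  "'a set \<Rightarrow> 'b set \<Rightarrow> nat \<Rightarrow> (nat \<Rightarrow> 'a \<Rightarrow> 'b) \<Rightarrow> real \<Rightarrow> real \<Rightarrow> bool" where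
  "strong_renyi2_extractor_qsi N M D f k \<epsilon> \<longleftrightarrow>
     (\<forall>d \<rho>. (\<forall>n\<in>N. \<rho> n \<in> carrier_mat d d) \<longrightarrow> psd (cq_op N d \<rho>) \<longrightarrow>
        cond_renyi2 (card N) d (cq_op N d \<rho>) \<ge> ereal k \<longrightarrow>
        cond_renyi2 (card (M \<times> {1..D})) d (cq_op (M \<times> {1..D}) d (ext_output_qsi N D f d \<rho>))
          \<ge> ereal (log 2 (real (card M) * real D / (\<epsilon> + 1))))"

end

theory Submission
  imports Defs "Jordan_Normal_Form.Spectral_Radius"
begin

text \<open>For \<open>T = \<rho>\<^sub>R\<^bsup>-1/2\<^esup> = K K\<^sup>*\<close> put \<open>Y\<^sub>n = K\<^sup>* \<rho>\<^sub>n K\<close>. Then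
  \<open>2\<^bsup>-H\<^sub>2(N|R)\<^esup> = \<Sum>\<^sub>n tr(\<rho>\<^sub>n T \<rho>\<^sub>n T) = \<Sum>\<^sub>n \<Sum>\<^sub>a\<^sub>b |Y\<^sub>n(a, b)|\<^sup>2\<close>, and since the output has the same
  marginal on \<open>R\<close>, the same formula with the same \<open>K\<close> holds for it. The classical
  extractor property bounds a quadratic form with non-negative coefficients on non-negative functions,
  hence also on complex ones by the triangle inequality. Applying it to \<open>n \<mapsto> Y\<^sub>n(a, b)\<close> for each
  \<open>a\<close>, \<open>b\<close> and summing gives the claim.\<close>

subsection \<open>The spectral theorem\<close>

lemma mat_adjoint_dim [simp]:
  "dim_row (mat_adjoint A) = dim_col A" "dim_col (mat_adjoint A) = dim_row A"
  unfolding mat_adjoint_def by auto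

lemma mat_adjoint_carrier [simp]: "A \<in> carrier_mat n m \<Longrightarrow> mat_adjoint A \<in> carrier_mat m n"
  by (auto intro!: carrier_matI)

lemma mat_adjoint_index [simp]:
  "i < dim_col A \<Longrightarrow> j < dim_row A \<Longrightarrow> mat_adjoint A $$ (i, j) = conjugate (A $$ (j, i))"
  unfolding mat_adjoint_def by (simp add: mat_of_rows_def)

lemma mat_adjoint_adjoint [simp]: "mat_adjoint (mat_adjoint A) = A"
  by (rule eq_matI) auto

lemma mat_adjoint_mult:
  fixes A B :: "complex mat"
  assumes "dim_col A = dim_row B"
  shows "mat_adjoint (A * B) = mat_adjoint B * mat_adjoint A"
  by (rule eq_matI) (use assms in \<open>auto simp: scalar_prod_def mult.commute\<close>)

lemma mat_adjoint_one [simp]: "mat_adjoint (1\<^sub>m n :: complex mat) = 1\<^sub>m n"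
  by (rule eq_matI) auto

lemma mat_adjoint_mat_diag: "mat_adjoint (mat_diag n e) = mat_diag n (\<lambda>i. cnj (e i))"
  by (rule eq_matI) (auto simp: mat_diag_def)

lemma mat_diag_dims [simp]: "dim_row (mat_diag n e) = n" "dim_col (mat_diag n e) = n"
  by (simp_all add: mat_diag_def)

lemma adjoint_mult_self_index:
  fixes U :: "complex mat"
  assumes "i < dim_col U" "j < dim_col U"
  shows "(mat_adjoint U * U) $$ (i, j) = col U j \<bullet>c col U i"
  using assms by (auto simp: scalar_prod_def mult.commute intro!: sum.cong)

lemma complex_cscalar_prod: 
  fixes v w :: "complex vec"
  assumes "v \<in> carrier_vec n" "w \<in> carrier_vec n"
  shows "v \<bullet>c w = (\<Sum>i<n. v $ i * cnj (w $ i))"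
  using assms by (auto simp: scalar_prod_def atLeast0LessThan)

lemma mult_carrier_square [simp]:
  "A \<in> carrier_mat n n \<Longrightarrow> B \<in> carrier_mat n n \<Longrightarrow> A * B \<in> carrier_mat n n"
  by (rule mult_carrier_mat)

lemma mult_mat_vec_carrier_square [simp]:
  "A \<in> carrier_mat n n \<Longrightarrow> v \<in> carrier_vec n \<Longrightarrow> A *\<^sub>v v \<in> carrier_vec n"
  by (rule mult_mat_vec_carrier)

definition unitary_mat :: "nat \<Rightarrow> complex mat \<Rightarrow> bool" where
  "unitary_mat n U \<longleftrightarrow> U \<in> carrier_mat n n \<and> mat_adjoint U * U = 1\<^sub>m n \<and> U * mat_adjoint U = 1\<^sub>m n"

text \<open>For square matrices a left inverse is also a right inverse, so one of the two equations
  suffices.\<close>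

lemma unitary_matI:
  assumes "U \<in> carrier_mat n n" "mat_adjoint U * U = 1\<^sub>m n"
  shows "unitary_mat n U"
  using assms mat_mult_left_right_inverse[of "mat_adjoint U" n U] by (simp add: unitary_mat_def)

lemma unitary_mat_mult:
  assumes "unitary_mat n U" "unitary_mat n V"
  shows "unitary_mat n (U * V)"
proof (rule unitary_matI)
  have U: "U \<in> carrier_mat n n" and V: "V \<in> carrier_mat n n" 
    and UU: "mat_adjoint U * U = 1\<^sub>m n" and VV: "mat_adjoint V * V = 1\<^sub>m n"
    using assms by (auto simp: unitary_mat_def)
  show "U * V \<in> carrier_mat n n" using U V by simp
  have "mat_adjoint (U * V) * (U * V) = mat_adjoint V * (mat_adjoint U * (U * V))"
    using U V by (simp add: mat_adjoint_mult assoc_mult_mat[of _ n n _ n _ n])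
  also have "mat_adjoint U * (U * V) = (mat_adjoint U * U) * V"
    using U V by (simp add: assoc_mult_mat[of _ n n _ n _ n])
  finally show "mat_adjoint (U * V) * (U * V) = 1\<^sub>m n" using V by (simp add: UU VV)
qed

text \<open>Supplies the rotation for the inductive step of the spectral theorem, where
  \<open>v\<close> is an eigenvector. Complete \<open>v\<close> to a basis, apply Gram-Schmidt with
  \<open>v\<close> as the head, and normalize; \<open>c\<close> is the reciprocal of the norm of
  \<open>v\<close>.\<close>

lemma exists_unitary_first_col:
  fixes v :: "complex vec"
  assumes v: "v \<in> carrier_vec n" and v0: "v \<noteq> 0\<^sub>v n"
  shows "\<exists>U c. unitary_mat n U \<and> col U 0 = c \<cdot>\<^sub>v v"
proof -
  have n: "n > 0" using v v0 by (cases n) auto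
  interpret cof_vec_space n "TYPE(complex)" .
  define b where "b = basis_completion v"
  define ws where "ws = gram_schmidt n b"
  from basis_completion[OF v v0, folded b_def]
  have dist_b: "distinct b" and indep: "\<not> lin_dep (set b)" and b: "set b \<subseteq> carrier_vec n"
    and hdb: "hd b = v" and len_b: "length b = n" by auto
  from hdb len_b n obtain vs where bv: "b = v # vs" by (cases b) auto
  from gram_schmidt_result[OF b dist_b indep refl, folded ws_def]
  have ws: "set ws \<subseteq> carrier_vec n" "corthogonal ws" "length ws = n" by (auto simp: len_b)
  have hdws: "hd ws = v" using gram_schmidt_hd[OF v, of vs, folded bv] by (simp add: ws_def)
  have ws0: "ws ! 0 = v" using hdws ws n by (metis hd_conv_nth length_0_conv less_numeral_extra(3))
  have wsc: "ws ! i \<in> carrier_vec n" if "i < n" for i using ws that by auto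
  \<comment> \<open>Gram-Schmidt delivers orthogonal vectors of arbitrary length; \<open>N j\<close>
    is the real factor that gives column \<open>j\<close> norm one.\<close>
  define N where "N i = complex_of_real (1 / sqrt (Re (ws ! i \<bullet>c ws ! i)))" for i
  define U where "U = mat n n (\<lambda>(i, j). N j * ws ! j $ i)"
  have U: "U \<in> carrier_mat n n" by (simp add: U_def)
  have col: "col U j = N j \<cdot>\<^sub>v ws ! j" if "j < n" for j
    using that wsc[OF that] by (intro eq_vecI) (auto simp: U_def)
  have "(mat_adjoint U * U) $$ (i, j) = 1\<^sub>m n $$ (i, j)" if ij: "i < n" "j < n" for i j
  proof -
    have "(mat_adjoint U * U) $$ (i, j) = (N j \<cdot>\<^sub>v ws ! j) \<bullet>c (N i \<cdot>\<^sub>v ws ! i)"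
      using ij U col by (subst adjoint_mult_self_index) auto
    also have "\<dots> = N j * cnj (N i) * (ws ! j \<bullet>c ws ! i)"
      using wsc[OF ij(1)] wsc[OF ij(2)] by (simp add: conjugate_smult_vec)
    also have "\<dots> = 1\<^sub>m n $$ (i, j)"
    proof (cases "i = j")
      case True
      have "ws ! i \<bullet>c ws ! i \<ge> 0" by (rule conjugate_square_ge_0_vec)
      moreover have "ws ! i \<bullet>c ws ! i \<noteq> 0" 
        using corthogonalD[OF ws(2), of i i] ij ws(3) by auto
      \<comment> \<open>Being non-negative in the order on the complex numbers includes being real,
        so the squared norm is a positive real \<open>r\<close> and its square root can be
        cancelled.\<close>
      ultimately obtain r where r: "ws ! i \<bullet>c ws ! i = complex_of_real r" "r > 0"
        by (metis complex_eq_iff complex_of_real_def Re_complex_of_real Im_complex_of_real less_eq_complex_def order_le_less zero_complex.sel)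
      have "N i * cnj (N i) * (ws ! i \<bullet>c ws ! i) = complex_of_real ((1 / sqrt r) * (1 / sqrt r) * r)"
        by (simp only: N_def r(1) complex_cnj_complex_of_real Re_complex_of_real of_real_mult)
      also have "(1 / sqrt r) * (1 / sqrt r) * r = 1" using r(2) by simp
      finally show ?thesis using True ij by simp
    next
      case False
      then show ?thesis using corthogonalD[OF ws(2), of j i] ij ws(3) by simp
    qed
    finally show ?thesis .
  qed
  then have "mat_adjoint U * U = 1\<^sub>m n" using U by (intro eq_matI) auto
  then show ?thesis using unitary_matI[OF U] col[OF n] ws0 by auto
qed

lemma four_block_zeros_adjoint:
  fixes A D :: "complex mat"
  assumes "A \<in> carrier_mat n n" "D \<in> carrier_mat m m"
  shows "mat_adjoint (four_block_mat A (0\<^sub>m n m) (0\<^sub>m m n) D)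
    = four_block_mat (mat_adjoint A) (0\<^sub>m n m) (0\<^sub>m m n) (mat_adjoint D)"
  using assms by (intro eq_matI) auto

lemma four_block_zeros_mult:
  fixes A D :: "complex mat"
  assumes "A \<in> carrier_mat n n" "D \<in> carrier_mat m m" "A' \<in> carrier_mat n n" "D' \<in> carrier_mat m m"
  shows "four_block_mat A (0\<^sub>m n m) (0\<^sub>m m n) D * four_block_mat A' (0\<^sub>m n m) (0\<^sub>m m n) D'
    = four_block_mat (A * A') (0\<^sub>m n m) (0\<^sub>m m n) (D * D')"
  using assms by (subst mult_four_block_mat[OF assms(1) _ _ assms(2) assms(3) _ _ assms(4)]) auto

text \<open>Induction on the dimension: rotate an eigenvector to the first basis vector, observe
  that Hermiticity splits off a 1 by 1 block, and diagonalize the remaining block. The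
  \<open>e\<close> are left complex; \<open>psd_spectral\<close> makes them real from
  positivity.\<close>

theorem hermitian_spectral:
  fixes A :: "complex mat"
  assumes "A \<in> carrier_mat n n" "mat_adjoint A = A"
  shows "\<exists>U e. unitary_mat n U \<and> A = U * mat_diag n e * mat_adjoint U"
  using assms
proof (induction n arbitrary: A)
  case 0
  then have "unitary_mat 0 (1\<^sub>m 0)" "A = 1\<^sub>m 0 * mat_diag 0 (\<lambda>_. 0) * mat_adjoint (1\<^sub>m 0)"
    by (auto simp: unitary_mat_def intro!: eq_matI)
  then show ?case by blast
next
  case (Suc n A)
  note A = Suc.prems(1) and h = Suc.prems(2)
  let ?m = "Suc n"
  obtain e where "eigenvalue A e"
    using spectrum_non_empty[OF A] by (auto simp: spectrum_def)
  then obtain v where v: "v \<in> carrier_vec ?m" "v \<noteq> 0\<^sub>v ?m" "A *\<^sub>v v = e \<cdot>\<^sub>v v"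
    using A by (auto simp: eigenvalue_def eigenvector_def)
  obtain U c where U: "unitary_mat ?m U" and c: "col U 0 = c \<cdot>\<^sub>v v"
    using exists_unitary_first_col[OF v(1,2)] by blast
  have Uc: "U \<in> carrier_mat ?m ?m" and UU: "mat_adjoint U * U = 1\<^sub>m ?m" "U * mat_adjoint U = 1\<^sub>m ?m"
    using U by (auto simp: unitary_mat_def)
  define A' where "A' = mat_adjoint U * A * U"
  have A': "A' \<in> carrier_mat ?m ?m" using Uc A by (simp add: A'_def)
  have hA': "mat_adjoint A' = A'"
    using Uc A by (simp add: A'_def mat_adjoint_mult h assoc_mult_mat[of _ ?m ?m _ ?m _ ?m])
  have eig: "A *\<^sub>v col U 0 = e \<cdot>\<^sub>v col U 0"
    unfolding c using A v by (simp add: mult_mat_vec[of _ ?m ?m] smult_smult_assoc mult.commute)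
  \<comment> \<open>The first column of \<open>A * U\<close> is \<open>e\<close> times that of
    \<open>U\<close>, and \<open>mat_adjoint U\<close> sends the latter to the first unit
    vector.\<close>
  have A'0: "A' $$ (i, 0) = (if i = 0 then e else 0)" if "i < ?m" for i
  proof -
    have "A' $$ (i, 0) = (mat_adjoint U * (A * U)) $$ (i, 0)"
      using Uc A by (simp add: A'_def assoc_mult_mat[of _ ?m ?m _ ?m _ ?m])
    also have "\<dots> = row (mat_adjoint U) i \<bullet> col (A * U) 0"
      using that Uc A by (subst index_mult_mat) auto
    also have "col (A * U) 0 = e \<cdot>\<^sub>v col U 0" 
      using col_mult2[OF A Uc, of 0] eig by simp
    also have "row (mat_adjoint U) i \<bullet> (e \<cdot>\<^sub>v col U 0) = e * (mat_adjoint U * U) $$ (i, 0)"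
      using that Uc by simp
    finally show ?thesis using that by (simp add: UU)
  qed
  \<comment> \<open>Hermiticity reflects the zeros of the first column into the first row. At the
    corner the value comes from the column formula again, which avoids showing that \<open>e\<close>
    is real.\<close>
  have A'0': "A' $$ (0, j) = (if j = 0 then e else 0)" if "j < ?m" for j
  proof -
    have "A' $$ (0, j) = cnj (A' $$ (j, 0))" 
      using A' that by (subst hA'[symmetric]) simp
    moreover have "A' $$ (0, j) = e" if "j = 0" using A'0[of 0] that by simp
    ultimately show ?thesis using A'0[OF that] by auto
  qed
  define B where "B = mat n n (\<lambda>(i, j). A' $$ (Suc i, Suc j))"
  have B: "B \<in> carrier_mat n n" by (simp add: B_def)
  have A'conj: "A' $$ (j, i) = cnj (A' $$ (i, j))" if "i < ?m" "j < ?m" for i j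
    using A' that by (subst hA'[symmetric]) simp
  have "mat_adjoint B = B"
    by (rule eq_matI) (simp_all add: B_def A'conj[symmetric])
  then obtain V g where V: "unitary_mat n V" and BV: "B = V * mat_diag n g * mat_adjoint V"
    using Suc.IH[OF B] by blast
  have Vc: "V \<in> carrier_mat n n" and VV: "mat_adjoint V * V = 1\<^sub>m n" "V * mat_adjoint V = 1\<^sub>m n"
    using V by (auto simp: unitary_mat_def)
  \<comment> \<open>In block form \<open>A'\<close> is \<open>E\<close> plus \<open>B\<close>; hence
    \<open>W\<close>, the direct sum of 1 and \<open>V\<close>, diagonalizes \<open>A'\<close>, and
    \<open>U * W\<close> diagonalizes \<open>A\<close>.\<close>
  define E where "E = mat 1 1 (\<lambda>_. e)"
  define W where "W = four_block_mat (1\<^sub>m 1) (0\<^sub>m 1 n) (0\<^sub>m n 1) V"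
  define G where "G = mat_diag ?m (case_nat e g)"
  have W: "W \<in> carrier_mat ?m ?m" unfolding W_def using four_block_carrier_mat[OF one_carrier_mat[of 1] Vc] by simp
  have Wadj: "mat_adjoint W = four_block_mat (1\<^sub>m 1) (0\<^sub>m 1 n) (0\<^sub>m n 1) (mat_adjoint V)"
    using Vc by (simp add: W_def four_block_zeros_adjoint)
  have "mat_adjoint W * W = four_block_mat (1\<^sub>m 1) (0\<^sub>m 1 n) (0\<^sub>m n 1) (1\<^sub>m n)"
    unfolding Wadj unfolding W_def using Vc by (simp add: four_block_zeros_mult VV)
  then have "mat_adjoint W * W = 1\<^sub>m ?m" by simp
  then have Wu: "unitary_mat ?m W" by (rule unitary_matI[OF W])
  have G: "G = four_block_mat E (0\<^sub>m 1 n) (0\<^sub>m n 1) (mat_diag n g)"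
    by (rule eq_matI) (auto simp: G_def mat_diag_def E_def split: nat.splits)
  have "A' = four_block_mat E (0\<^sub>m 1 n) (0\<^sub>m n 1) B"
    using A' by (intro eq_matI) (auto simp: E_def B_def A'0 A'0')
  also have "\<dots> = W * G * mat_adjoint W"
    unfolding G W_def four_block_zeros_adjoint[OF one_carrier_mat Vc]
    using Vc by (simp add: four_block_zeros_mult E_def BV)
  finally have A'W: "A' = W * G * mat_adjoint W" .
  have Gc: "G \<in> carrier_mat ?m ?m" by (simp add: G_def)
  have "U * A' * mat_adjoint U = (U * mat_adjoint U) * A * (U * mat_adjoint U)"
    using Uc A by (simp add: A'_def assoc_mult_mat[of _ ?m ?m _ ?m _ ?m])
  then have "A = U * A' * mat_adjoint U" using A by (simp add: UU)
  also have "\<dots> = (U * W) * G * mat_adjoint (U * W)"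
    unfolding A'W using Uc W Gc 
    by (simp add: mat_adjoint_mult assoc_mult_mat[of _ ?m ?m _ ?m _ ?m])
  finally show ?case using unitary_mat_mult[OF U Wu] unfolding G_def by blast
qed

subsection \<open>Positive semi-definite matrices\<close>

lemma quadratic_form_sum:
  fixes A :: "complex mat"
  assumes "A \<in> carrier_mat n n" "v \<in> carrier_vec n" "w \<in> carrier_vec n"
  shows "(A *\<^sub>v v) \<bullet>c w = (\<Sum>i<n. \<Sum>j<n. A $$ (i, j) * v $ j * cnj (w $ i))"
  using assms
  by (auto simp: scalar_prod_def atLeast0LessThan sum_distrib_right intro!: sum.cong)

lemma psd_iff:
  assumes "A \<in> carrier_mat n n"
  shows "psd A \<longleftrightarrow> (\<forall>v\<in>carrier_vec n. 0 \<le> (A *\<^sub>v v) \<bullet>c v)"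
  using assms by (auto simp: psd_def square_mat.simps)

text \<open>Polarization: the quadratic form is real on every combination of two basis vectors, and
  a few choices of coefficients then determine how opposite entries are related.\<close>

lemma psd_hermitian:
  assumes A: "A \<in> carrier_mat n n" and p: "psd A"
  shows "mat_adjoint A = A"
proof -
  \<comment> \<open>The case \<open>i = j\<close> is included: coordinates are written as sums of
    two conditionals, so coinciding contributions add up.\<close>
  have q: "(A *\<^sub>v v) \<bullet>c v = A $$ (i, i) * c * cnj c + A $$ (i, j) * d * cnj c
      + A $$ (j, i) * c * cnj d + A $$ (j, j) * d * cnj d"
    if "i < n" "j < n" "v = c \<cdot>\<^sub>v unit_vec n i + d \<cdot>\<^sub>v unit_vec n j" for v i j c d
  proof -
    have v: "v \<in> carrier_vec n" using that by simp
    have "(A *\<^sub>v v) $ k = A $$ (k, i) * c + A $$ (k, j) * d" if "k < n" for k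
    proof -
      have "(A *\<^sub>v v) $ k = (\<Sum>l<n. A $$ (k, l) * v $ l)"
        using \<open>k < n\<close> A v by (simp add: scalar_prod_def atLeast0LessThan)
      also have "\<dots> = (\<Sum>l<n. (if l = i then A $$ (k, l) * c else 0) + (if l = j then A $$ (k, l) * d else 0))"
        using \<open>i < n\<close> \<open>j < n\<close> \<open>v = _\<close> by (intro sum.cong) (auto simp: algebra_simps)
      finally show ?thesis using \<open>i < n\<close> \<open>j < n\<close> by (simp add: sum.distrib)
    qed
    note Av = this
    have vk: "cnj (v $ k) = (if k = i then cnj c else 0) + (if k = j then cnj d else 0)" if "k < n" for k
      using that \<open>i < n\<close> \<open>j < n\<close> by (simp add: \<open>v = _\<close>)
    have "(A *\<^sub>v v) \<bullet>c v = (\<Sum>k<n. (A *\<^sub>v v) $ k * cnj (v $ k))"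
      using A v by (intro complex_cscalar_prod) auto
    also have "\<dots> = (\<Sum>k<n. (if k = i then (A $$ (k, i) * c + A $$ (k, j) * d) * cnj c else 0)
      + (if k = j then (A $$ (k, i) * c + A $$ (k, j) * d) * cnj d else 0))"
      using that(1,2) by (intro sum.cong refl) (simp add: Av vk distrib_left)
    finally have "(A *\<^sub>v v) \<bullet>c v = (\<Sum>k<n. (if k = i then (A $$ (k, i) * c + A $$ (k, j) * d) * cnj c else 0)
      + (if k = j then (A $$ (k, i) * c + A $$ (k, j) * d) * cnj d else 0))" .
    then show ?thesis using that(1,2) by (simp add: sum.distrib algebra_simps)
  qed
  have im: "Im (A $$ (i, i) * c * cnj c + A $$ (i, j) * d * cnj c
      + A $$ (j, i) * c * cnj d + A $$ (j, j) * d * cnj d) = 0" if "i < n" "j < n" for i j c d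
    using q[OF that refl, of c d] p psd_iff[OF A]
    by (metis add_carrier_vec smult_carrier_vec unit_vec_carrier less_eq_complex_def zero_complex.sel(2))
  \<comment> \<open>Coefficients (1,0) and (0,1) make the diagonal entries real; (1,1) makes the
    imaginary parts of the two off-diagonal entries opposite; (1,\<i>) makes their real parts
    equal.\<close>
  have "A $$ (i, j) = cnj (A $$ (j, i))" if "i < n" "j < n" for i j
    using im[OF that, of 1 0] im[OF that, of 0 1] im[OF that, of 1 1] im[OF that, of 1 \<i>]
    by (auto simp: complex_eq_iff)
  note this[symmetric]
  then show ?thesis using A by (intro eq_matI) auto
qed

lemma adjoint_mult_vec_cscalar:
  fixes A :: "complex mat"
  assumes "A \<in> carrier_mat n n" "v \<in> carrier_vec n" "w \<in> carrier_vec n"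
  shows "(A *\<^sub>v v) \<bullet>c w = v \<bullet>c (mat_adjoint A *\<^sub>v w)"
proof -
  have "v \<bullet>c (mat_adjoint A *\<^sub>v w) = (\<Sum>j<n. v $ j * cnj ((mat_adjoint A *\<^sub>v w) $ j))"
    using assms by (intro complex_cscalar_prod) auto
  also have "\<dots> = (\<Sum>j<n. \<Sum>i<n. A $$ (i, j) * v $ j * cnj (w $ i))"
    using assms by (auto simp: scalar_prod_def atLeast0LessThan sum_distrib_left mult_ac intro!: sum.cong)
  also have "\<dots> = (A *\<^sub>v v) \<bullet>c w"
    unfolding quadratic_form_sum[OF assms] by (rule sum.swap)
  finally show ?thesis by simp
qed

text \<open>The quadratic form at \<open>v\<close> is the squared norm of
  \<open>mat_adjoint S *\<^sub>v v\<close>.\<close>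

lemma psd_mult_adjoint:
  assumes S: "S \<in> carrier_mat n n"
  shows "psd (S * mat_adjoint S)"
  unfolding psd_iff[OF mult_carrier_square[OF S mat_adjoint_carrier[OF S]]]
proof
  fix v :: "complex vec" assume v: "v \<in> carrier_vec n"
  have w: "mat_adjoint S *\<^sub>v v \<in> carrier_vec n" using S v by auto
  have "(S * mat_adjoint S *\<^sub>v v) \<bullet>c v = (S *\<^sub>v (mat_adjoint S *\<^sub>v v)) \<bullet>c v"
    using S v by (simp add: assoc_mult_mat_vec[of _ n n _ n])
  also have "\<dots> = (mat_adjoint S *\<^sub>v v) \<bullet>c (mat_adjoint S *\<^sub>v v)"
    by (rule adjoint_mult_vec_cscalar[OF S w v])
  finally show "0 \<le> (S * mat_adjoint S *\<^sub>v v) \<bullet>c v" by (simp add: conjugate_square_ge_0_vec)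
qed

section \<open>Functions of a positive semi-definite matrix: square root and generalized
  inverse\<close>

text \<open>Functional calculus with a fixed eigenbasis: a function of \<open>udiag n U e\<close>
  keeps \<open>U\<close> and acts on the real eigenvalues \<open>e\<close>, so matrix identities
  reduce to pointwise ones.\<close>

definition udiag :: "nat \<Rightarrow> complex mat \<Rightarrow> (nat \<Rightarrow> real) \<Rightarrow> complex mat" where
  "udiag n U e = U * mat_diag n (\<lambda>i. complex_of_real (e i)) * mat_adjoint U"

lemma udiag_carrier [simp]: "unitary_mat n U \<Longrightarrow> udiag n U e \<in> carrier_mat n n"
  by (simp add: udiag_def unitary_mat_def)

lemma udiag_adjoint [simp]: "unitary_mat n U \<Longrightarrow> mat_adjoint (udiag n U e) = udiag n U e"
  by (auto simp: udiag_def unitary_mat_def mat_adjoint_mult mat_adjoint_mat_diag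
      assoc_mult_mat[of _ n n _ n _ n])

lemma udiag_mult:
  assumes "unitary_mat n U"
  shows "udiag n U e * udiag n U g = udiag n U (\<lambda>i. e i * g i)"
proof -
  let ?D = "\<lambda>e. mat_diag n (\<lambda>i. complex_of_real (e i))"
  have U: "U \<in> carrier_mat n n" "mat_adjoint U * U = 1\<^sub>m n" using assms by (auto simp: unitary_mat_def)
  have "udiag n U e * udiag n U g = U * ?D e * (mat_adjoint U * U) * ?D g * mat_adjoint U"
    using U(1) by (simp add: udiag_def assoc_mult_mat[of _ n n _ n _ n])
  also have "\<dots> = U * (?D e * ?D g) * mat_adjoint U"
    using U(1) by (simp add: U(2) assoc_mult_mat[of _ n n _ n _ n] left_mult_one_mat[of _ n n] del: mat_diag_diag)
  finally show ?thesis by (simp add: udiag_def)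
qed

text \<open>Each eigenvalue is the value of the quadratic form at a column of the unitary, hence
  real and non-negative.\<close>

lemma psd_spectral:
  assumes A: "A \<in> carrier_mat n n" and p: "psd A"
  obtains U e where "unitary_mat n U" "\<And>i. 0 \<le> e i" "A = udiag n U e"
proof -
  obtain U g where U: "unitary_mat n U" and Ag: "A = U * mat_diag n g * mat_adjoint U"
    using hermitian_spectral[OF A psd_hermitian[OF A p]] by blast
  have Uc: "U \<in> carrier_mat n n" and UU: "mat_adjoint U * U = 1\<^sub>m n" using U by (auto simp: unitary_mat_def)
  have "mat_adjoint U * (A * U) = (mat_adjoint U * U) * mat_diag n g * (mat_adjoint U * U)"
    using Uc by (simp add: Ag assoc_mult_mat[of _ n n _ n _ n])
  then have D: "mat_adjoint U * (A * U) = mat_diag n g" by (simp add: UU left_mult_one_mat[of _ n n] right_mult_one_mat[of _ n n])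
  have g0: "0 \<le> g i" if i: "i < n" for i
  proof -
    have "g i = (mat_adjoint U * (A * U)) $$ (i, i)" using i by (simp add: D mat_diag_def)
    also have "\<dots> = conjugate (col U i) \<bullet> (A *\<^sub>v col U i)"
      using i Uc A by (auto simp: scalar_prod_def intro!: sum.cong)
    also have "\<dots> = (A *\<^sub>v col U i) \<bullet>c col U i"
      using i Uc A by (intro conjugate_vec_sprod_comm[symmetric, of _ n]) auto
    finally show ?thesis using p i Uc by (simp add: psd_iff[OF A])
  qed
  \<comment> \<open>The value 0 beyond the dimension lets non-negativity hold for every
    index.\<close>
  define e where "e i = (if i < n then Re (g i) else 0)" for i
  have "mat_diag n g = mat_diag n (\<lambda>i. complex_of_real (e i))"
    by (rule eq_matI) (use g0 in \<open>auto simp: mat_diag_def e_def less_eq_complex_def complex_eq_iff\<close>)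
  moreover have "0 \<le> e i" for i using g0 by (auto simp: e_def less_eq_complex_def)
  ultimately show ?thesis using that[OF U, of e] Ag by (simp add: udiag_def)
qed

text \<open>With \<open>W = mat_adjoint U * V\<close> connecting the two eigenbases, equality of the
  squares reads \<open>b i * b i * W $$ (i, j) = W $$ (i, j) * (c j * c j)\<close>. Where the entry
  of \<open>W\<close> is non-zero, the non-negative numbers \<open>b i\<close> and
  \<open>c j\<close> have equal squares and so agree; undoing the rotations gives
  \<open>B = C\<close>.\<close>

lemma psd_sqrt_unique:
  assumes B: "B \<in> carrier_mat n n" "psd B" and C: "C \<in> carrier_mat n n" "psd C" and eq: "B * B = C * C"
  shows "B = C"
proof -
  obtain U b where U: "unitary_mat n U" and b: "\<And>i. 0 \<le> b i" and Bu: "B = udiag n U b"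
    using psd_spectral[OF B] by blast
  obtain V c where V: "unitary_mat n V" and c: "\<And>i. 0 \<le> c i" and Cv: "C = udiag n V c"
    using psd_spectral[OF C] by blast
  let ?D = "\<lambda>e. mat_diag n (\<lambda>i. complex_of_real (e i))"
  have Uc: "U \<in> carrier_mat n n" and UU: "mat_adjoint U * U = 1\<^sub>m n" "U * mat_adjoint U = 1\<^sub>m n"
    using U by (auto simp: unitary_mat_def)
  have Vc: "V \<in> carrier_mat n n" and VV: "mat_adjoint V * V = 1\<^sub>m n" "V * mat_adjoint V = 1\<^sub>m n"
    using V by (auto simp: unitary_mat_def)
  define W where "W = mat_adjoint U * V"
  have W: "W \<in> carrier_mat n n" using Uc Vc by (simp add: W_def)
  have l: "mat_adjoint U * udiag n U e * V = ?D e * W" for e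
  proof -
    have "mat_adjoint U * udiag n U e * V = (mat_adjoint U * U) * ?D e * W"
      using Uc Vc by (simp add: udiag_def W_def assoc_mult_mat[of _ n n _ n _ n])
    then show ?thesis by (simp add: UU)
  qed
  have r: "mat_adjoint U * udiag n V e * V = W * ?D e" for e
  proof -
    have "mat_adjoint U * udiag n V e * V = W * ?D e * (mat_adjoint V * V)"
      using Uc Vc by (simp add: udiag_def W_def assoc_mult_mat[of _ n n _ n _ n])
    then show ?thesis using W by (simp add: VV mult_carrier_square[of _ n])
  qed
  have "udiag n U (\<lambda>i. b i * b i) = udiag n V (\<lambda>i. c i * c i)"
    using eq by (simp add: Bu Cv udiag_mult U V)
  then have sq: "?D (\<lambda>i. b i * b i) * W = W * ?D (\<lambda>i. c i * c i)"
    using l r by metis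
  have "b i * W $$ (i, j) = W $$ (i, j) * c j" if ij: "i < n" "j < n" for i j
  proof (cases "W $$ (i, j) = 0")
    case False
    have "complex_of_real (b i * b i) * W $$ (i, j) = W $$ (i, j) * complex_of_real (c j * c j)"
      using arg_cong[OF sq, of "\<lambda>X. X $$ (i, j)"] ij W
      by (simp add: mat_diag_mult_left[OF W] mat_diag_mult_right[OF W])
    then have "complex_of_real (b i * b i) = complex_of_real (c j * c j)" using False by simp
    then have "b i * b i = c j * c j" unfolding of_real_eq_iff .
    then have "b i = c j" using b[of i] c[of j]
      by (metis abs_of_nonneg real_sqrt_mult_self real_sqrt_mult)
    then show ?thesis by simp
  qed simp
  then have "?D b * W = W * ?D c"
    by (intro eq_matI) (simp_all add: mat_diag_mult_left[OF W] mat_diag_mult_right[OF W])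
  then have "mat_adjoint U * B * V = mat_adjoint U * C * V" by (simp add: Bu Cv l r)
  then have "U * (mat_adjoint U * B * V) * mat_adjoint V = U * (mat_adjoint U * C * V) * mat_adjoint V" by simp
  moreover have "U * (mat_adjoint U * X * V) * mat_adjoint V = X" if X: "X \<in> carrier_mat n n" for X
  proof -
    have "U * (mat_adjoint U * X * V) * mat_adjoint V = (U * mat_adjoint U) * X * (V * mat_adjoint V)"
      using Uc Vc X by (simp add: assoc_mult_mat[of _ n n _ n _ n])
    then show ?thesis using X by (simp add: UU VV)
  qed
  ultimately show ?thesis using B C by simp
qed

lemma psd_sqrt_eqI:
  assumes B: "B \<in> carrier_mat n n" "psd B" and eq: "B * B = A"
  shows "psd_sqrt A = B"
  unfolding psd_sqrt_def
proof (rule the_equality)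
  fix C assume C: "psd C \<and> C * C = A"
  have A: "A \<in> carrier_mat n n" using B eq by auto
  \<comment> \<open>\<open>psd\<close> fixes no dimension, so that of the competitor
    \<open>C\<close> is read off from \<open>C * C = A\<close>.\<close>
  have "dim_row C = n" using A C index_mult_mat(2)[of C C] by auto
  moreover have "dim_col C = n" using A C index_mult_mat(3)[of C C] by auto
  ultimately have "C \<in> carrier_mat n n" by auto
  then show "C = B" using psd_sqrt_unique[of C n B] B C eq by simp
qed (use B eq in simp)

text \<open>The predicate inside the definite description of \<open>pseudo_inverse\<close>, named so
  that its uniqueness can be stated.\<close>

definition penrose :: "complex mat \<Rightarrow> complex mat \<Rightarrow> bool" where
  "penrose A X \<longleftrightarrow> X \<in> carrier_mat (dim_col A) (dim_row A) \<and>
     A * X * A = A \<and> X * A * X = X \<and>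
     mat_adjoint (A * X) = A * X \<and> mat_adjoint (X * A) = X * A"

text \<open>Inserting \<open>A = A * Y * A\<close> and taking adjoints shows that both candidates
  give the same \<open>A * X\<close> and the same \<open>X * A\<close>; then X = XAX = XAY = YAY =
  Y.\<close>

lemma penrose_unique:
  assumes A: "A \<in> carrier_mat n n" and X: "penrose A X" and Y: "penrose A Y"
  shows "X = Y"
proof -
  have c: "X \<in> carrier_mat n n" "Y \<in> carrier_mat n n"
    using A X Y by (auto simp: penrose_def)
  note as = assoc_mult_mat[of _ n n _ n _ n]
  have x: "A * X * A = A" "X * A * X = X" "mat_adjoint (A * X) = A * X" "mat_adjoint (X * A) = X * A"
    and y: "A * Y * A = A" "Y * A * Y = Y" "mat_adjoint (A * Y) = A * Y" "mat_adjoint (Y * A) = Y * A"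
    using X Y by (auto simp: penrose_def)
  have "A * X = mat_adjoint ((A * Y * A) * X)" by (simp only: x y)
  also have "\<dots> = mat_adjoint ((A * Y) * (A * X))" using A c by (simp add: as)
  also have "\<dots> = (A * X) * (A * Y)" using A c x y by (subst mat_adjoint_mult) auto
  also have "\<dots> = (A * X * A) * Y" using A c by (simp add: as)
  finally have 1: "A * X = A * Y" by (simp only: x)
  have "X * A = mat_adjoint (X * (A * Y * A))" by (simp only: x y)
  also have "\<dots> = mat_adjoint ((X * A) * (Y * A))" using A c by (simp add: as)
  also have "\<dots> = (Y * A) * (X * A)" using A c x y by (subst mat_adjoint_mult) auto
  also have "\<dots> = Y * (A * X * A)" using A c by (simp add: as)
  finally have 2: "X * A = Y * A" by (simp only: x)
  have "X = X * (A * X)" using x(2) A c by (simp add: as)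
  also have "\<dots> = (X * A) * Y" using A c by (simp add: 1 as)
  also have "\<dots> = Y" by (simp only: 2 y)
  finally show ?thesis .
qed

lemma pseudo_inverse_eqI:
  assumes "A \<in> carrier_mat n n" "penrose A X"
  shows "pseudo_inverse A = X"
  unfolding pseudo_inverse_def penrose_def[symmetric]
  by (rule the_equality) (use assms penrose_unique in auto)

subsection \<open>Block-diagonal matrices\<close>

text \<open>Direct sum of \<open>a\<close> blocks, indexed as in \<open>kron\<close>: block number
  \<open>p div d\<close>, position \<open>p mod d\<close> inside it. Classical-quantum operators and
  \<open>kron (1\<^sub>m a) B\<close> both take this form.\<close>

definition bdiag :: "nat \<Rightarrow> nat \<Rightarrow> (nat \<Rightarrow> complex mat) \<Rightarrow> complex mat" where
  "bdiag a d R = mat (a * d) (a * d)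
     (\<lambda>(p, q). if p div d = q div d then R (p div d) $$ (p mod d, q mod d) else 0)"

lemma bdiag_dims [simp]: "dim_row (bdiag a d R) = a * d" "dim_col (bdiag a d R) = a * d"
  by (simp_all add: bdiag_def)

lemma bdiag_carrier [simp]: "bdiag a d R \<in> carrier_mat (a * d) (a * d)"
  by (simp add: bdiag_def)

lemma div_mod_less_mult:
  assumes "(p::nat) < a * d"
  shows "p div d < a" "p mod d < d"
  using assms by (cases "d = 0"; simp add: less_mult_imp_div_less)+

lemma block_index_less:
  assumes "(x::nat) < a" "i < d"
  shows "x * d + i < a * d"
proof -
  have "x * d + i < Suc x * d" using assms by simp
  also have "\<dots> \<le> a * d" using assms by (intro mult_le_mono1) simp
  finally show ?thesis .
qed

lemma bdiag_index:
  "p < a * d \<Longrightarrow> q < a * d \<Longrightarrow>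
    bdiag a d R $$ (p, q) = (if p div d = q div d then R (p div d) $$ (p mod d, q mod d) else 0)"
  by (simp add: bdiag_def)

lemma bdiag_block_index:
  "x < a \<Longrightarrow> y < a \<Longrightarrow> i < d \<Longrightarrow> j < d \<Longrightarrow>
    bdiag a d R $$ (x * d + i, y * d + j) = (if x = y then R x $$ (i, j) else 0)"
  by (simp add: bdiag_index block_index_less)

lemma sum_blocks:
  "(\<Sum>p<a * d. g p) = (\<Sum>x<a. \<Sum>i<d. g (x * d + i))" for g :: "nat \<Rightarrow> 'b::comm_monoid_add"
proof -
  have "(\<Sum>p<a * d. g p) = (\<Sum>x<a. sum g {x * d..<x * d + d})"
    by (rule sum.nat_group[symmetric])
  moreover have "sum g {x * d..<x * d + d} = (\<Sum>i<d. g (x * d + i))" for x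
    using sum.shift_bounds_nat_ivl[of g 0 "x * d" d] by (simp add: atLeast0LessThan add.commute)
  ultimately show ?thesis by simp
qed

lemma bdiag_mult:
  assumes "\<And>x. x < a \<Longrightarrow> R x \<in> carrier_mat d d" "\<And>x. x < a \<Longrightarrow> R' x \<in> carrier_mat d d"
  shows "bdiag a d R * bdiag a d R' = bdiag a d (\<lambda>x. R x * R' x)"
proof (rule eq_matI)
  fix p q assume "p < dim_row (bdiag a d (\<lambda>x. R x * R' x))" "q < dim_col (bdiag a d (\<lambda>x. R x * R' x))"
  then have pq: "p < a * d" "q < a * d" by simp_all
  note b = div_mod_less_mult[OF pq(1)] div_mod_less_mult[OF pq(2)]
  note R = assms(1)[OF b(1)] assms(2)[OF b(3)]
  have "(bdiag a d R * bdiag a d R') $$ (p, q) = (\<Sum>r<a * d. bdiag a d R $$ (p, r) * bdiag a d R' $$ (r, q))"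
    using pq by (simp add: scalar_prod_def atLeast0LessThan)
  also have "\<dots> = (\<Sum>x<a. \<Sum>i<d. bdiag a d R $$ (p, x * d + i) * bdiag a d R' $$ (x * d + i, q))"
    by (rule sum_blocks)
  \<comment> \<open>Only the block containing \<open>p\<close> meets row \<open>p\<close>, and there
    the second factor vanishes unless \<open>q\<close> lies in the same block.\<close>
  also have "\<dots> = (\<Sum>x<a. if x = p div d then (\<Sum>i<d. if p div d = q div d then
      R (p div d) $$ (p mod d, i) * R' (q div d) $$ (i, q mod d) else 0) else 0)"
  proof (rule sum.cong[OF refl])
    fix x assume "x \<in> {..<a}"
    then show "(\<Sum>i<d. bdiag a d R $$ (p, x * d + i) * bdiag a d R' $$ (x * d + i, q))
      = (if x = p div d then (\<Sum>i<d. if p div d = q div d then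
      R (p div d) $$ (p mod d, i) * R' (q div d) $$ (i, q mod d) else 0) else 0)"
      using pq by (cases "x = p div d") (auto simp: bdiag_index block_index_less intro!: sum.cong sum.neutral)
  qed
  also have "\<dots> = (\<Sum>i<d. if p div d = q div d then
      R (p div d) $$ (p mod d, i) * R' (q div d) $$ (i, q mod d) else 0)"
    using b by simp
  also have "\<dots> = bdiag a d (\<lambda>x. R x * R' x) $$ (p, q)"
    using pq b R by (cases "p div d = q div d") (simp_all add: bdiag_index scalar_prod_def atLeast0LessThan)
  finally show "(bdiag a d R * bdiag a d R') $$ (p, q) = bdiag a d (\<lambda>x. R x * R' x) $$ (p, q)" .
qed simp_all

lemma bdiag_adjoint:
  assumes "\<And>x. x < a \<Longrightarrow> R x \<in> carrier_mat d d"
  shows "mat_adjoint (bdiag a d R) = bdiag a d (\<lambda>x. mat_adjoint (R x))"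
proof (rule eq_matI)
  fix p q assume "p < dim_row (bdiag a d (\<lambda>x. mat_adjoint (R x)))" "q < dim_col (bdiag a d (\<lambda>x. mat_adjoint (R x)))"
  then have pq: "p < a * d" "q < a * d" by simp_all
  note b = div_mod_less_mult[OF pq(1)] div_mod_less_mult[OF pq(2)]
  show "mat_adjoint (bdiag a d R) $$ (p, q) = bdiag a d (\<lambda>x. mat_adjoint (R x)) $$ (p, q)"
    using pq b assms[OF b(1)] assms[OF b(3)] by (auto simp: bdiag_index)
qed simp_all

lemma kron_one_left:
  assumes "B \<in> carrier_mat d d"
  shows "kron (1\<^sub>m a) B = bdiag a d (\<lambda>_. B)"
  by (rule eq_matI) (use assms in \<open>auto simp: kron_def bdiag_index div_mod_less_mult\<close>)

lemma mat_trace_bdiag: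
  assumes "\<And>x. x < a \<Longrightarrow> R x \<in> carrier_mat d d"
  shows "mat_trace (bdiag a d R) = (\<Sum>x<a. mat_trace (R x))"
proof -
  have "mat_trace (bdiag a d R) = (\<Sum>x<a. \<Sum>i<d. bdiag a d R $$ (x * d + i, x * d + i))"
    by (simp add: mat_trace_def sum_blocks)
  also have "\<dots> = (\<Sum>x<a. mat_trace (R x))"
    using assms by (intro sum.cong refl) (auto simp: mat_trace_def bdiag_block_index)
  finally show ?thesis .
qed

lemma ptrace1_bdiag: "ptrace1 a d (bdiag a d R) = msum d R {..<a}"
  by (rule eq_matI) (auto simp: ptrace1_def msum_def bdiag_block_index intro!: sum.cong)

lemma msum_carrier [simp]: "msum d F S \<in> carrier_mat d d"
  by (simp add: msum_def)

section \<open>Classical-quantum operators as direct sums; positivity of their blocks and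
  marginals\<close>

text \<open>\<open>basis_proj S s\<close> is a diagonal matrix unit, so its Kronecker product with
  \<open>\<rho> s\<close> just places \<open>\<rho> s\<close> in the block numbered
  \<open>to_nat_on S s\<close>.\<close>

lemma cq_op_eq_bdiag:
  assumes fin: "finite S" and \<rho>: "\<And>s. s \<in> S \<Longrightarrow> \<rho> s \<in> carrier_mat d d"
  shows "cq_op S d \<rho> = bdiag (card S) d (\<lambda>x. \<rho> (from_nat_into S x))"
proof (rule eq_matI)
  fix p q assume "p < dim_row (bdiag (card S) d (\<lambda>x. \<rho> (from_nat_into S x)))"
    "q < dim_col (bdiag (card S) d (\<lambda>x. \<rho> (from_nat_into S x)))"
  then have pq: "p < card S * d" "q < card S * d" by simp_all
  note b = div_mod_less_mult[OF pq(1)] div_mod_less_mult[OF pq(2)]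
  have "cq_op S d \<rho> $$ (p, q) = (\<Sum>s\<in>S. kron (basis_proj S s) (\<rho> s) $$ (p, q))"
    using pq by (simp add: cq_op_def msum_def)
  \<comment> \<open>Writing \<open>s\<close> as \<open>from_nat_into S (to_nat_on S s)\<close> makes
    the summand depend on the index of \<open>s\<close> alone, which prepares the
    reindexing.\<close>
  also have "\<dots> = (\<Sum>s\<in>S. if p div d = to_nat_on S s \<and> q div d = to_nat_on S s
      then \<rho> (from_nat_into S (to_nat_on S s)) $$ (p mod d, q mod d) else 0)"
  proof (rule sum.cong[OF refl])
    fix s assume s: "s \<in> S"
    have "from_nat_into S (to_nat_on S s) = s" using s fin by (simp add: countable_finite)
    then show "kron (basis_proj S s) (\<rho> s) $$ (p, q) = (if p div d = to_nat_on S s \<and> q div d = to_nat_on S s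
      then \<rho> (from_nat_into S (to_nat_on S s)) $$ (p mod d, q mod d) else 0)"
      using pq b \<rho>[OF s] by (auto simp: kron_def basis_proj_def)
  qed
  also have "\<dots> = (\<Sum>x<card S. if p div d = x \<and> q div d = x
      then \<rho> (from_nat_into S x) $$ (p mod d, q mod d) else 0)"
    by (rule sum.reindex_bij_betw[OF to_nat_on_finite[OF fin]])
  also have "\<dots> = (\<Sum>x<card S. if x = p div d then (if p div d = q div d
      then \<rho> (from_nat_into S x) $$ (p mod d, q mod d) else 0) else 0)"
    by (rule sum.cong) auto
  also have "\<dots> = bdiag (card S) d (\<lambda>x. \<rho> (from_nat_into S x)) $$ (p, q)"
    using pq b by (simp add: bdiag_index)
  finally show "cq_op S d \<rho> $$ (p, q) = bdiag (card S) d (\<lambda>x. \<rho> (from_nat_into S x)) $$ (p, q)" .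
qed (simp_all add: cq_op_def msum_def)

lemma sum_from_nat_into:
  assumes "finite S"
  shows "(\<Sum>x<card S. g (from_nat_into S x)) = sum g S"
proof -
  have "(\<Sum>x<card S. g (from_nat_into S x)) = (\<Sum>s\<in>S. g (from_nat_into S (to_nat_on S s)))"
    by (rule sum.reindex_bij_betw[OF to_nat_on_finite[OF assms], symmetric])
  also have "\<dots> = sum g S" using assms by (intro sum.cong) (auto simp: countable_finite)
  finally show ?thesis .
qed

lemma from_nat_into_mem: "x < card S \<Longrightarrow> from_nat_into S x \<in> S"
  by (rule from_nat_into) auto

lemma ptrace1_cq_op:
  assumes "finite S" "\<And>s. s \<in> S \<Longrightarrow> \<rho> s \<in> carrier_mat d d"
  shows "ptrace1 (card S) d (cq_op S d \<rho>) = msum d \<rho> S"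
proof -
  have "ptrace1 (card S) d (cq_op S d \<rho>) = msum d (\<lambda>x. \<rho> (from_nat_into S x)) {..<card S}"
    using assms by (simp add: cq_op_eq_bdiag ptrace1_bdiag)
  also have "\<dots> = msum d \<rho> S"
    by (rule eq_matI)
      (auto simp: msum_def sum_from_nat_into[OF assms(1), of "\<lambda>s. \<rho> s $$ (_, _)"])
  finally show ?thesis .
qed

text \<open>On vectors supported in block \<open>x\<close>, the form of the direct sum is the form
  of \<open>R x\<close>.\<close>

lemma psd_bdiag_block:
  assumes p: "psd (bdiag a d R)" and x: "x < a" and R: "R x \<in> carrier_mat d d"
  shows "psd (R x)"
  unfolding psd_iff[OF R]
proof
  fix v :: "complex vec" assume v: "v \<in> carrier_vec d"
  define w where "w = vec (a * d) (\<lambda>p. if p div d = x then v $ (p mod d) else 0)"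
  have w: "w \<in> carrier_vec (a * d)" by (simp add: w_def)
  have wi: "w $ (y * d + i) = (if y = x then v $ i else 0)" if "y < a" "i < d" for y i
    using that by (simp add: w_def block_index_less)
  have "(bdiag a d R *\<^sub>v w) \<bullet>c w
    = (\<Sum>y<a. \<Sum>i<d. \<Sum>z<a. \<Sum>j<d. bdiag a d R $$ (y * d + i, z * d + j) * w $ (z * d + j) * cnj (w $ (y * d + i)))"
    unfolding quadratic_form_sum[OF bdiag_carrier w w] sum_blocks ..
  also have "\<dots> = (\<Sum>y<a. \<Sum>i<d. \<Sum>z<a. if z = x then (if y = x then (\<Sum>j<d. R x $$ (i, j) * v $ j * cnj (v $ i)) else 0) else 0)"
    using x by (intro sum.cong refl) (auto simp: bdiag_block_index wi)
  also have "\<dots> = (\<Sum>y<a. if y = x then (\<Sum>i<d. \<Sum>j<d. R x $$ (i, j) * v $ j * cnj (v $ i)) else 0)"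
    using x by (intro sum.cong refl) auto
  also have "\<dots> = (R x *\<^sub>v v) \<bullet>c v"
    using x by (simp add: quadratic_form_sum[OF R v v])
  finally show "0 \<le> (R x *\<^sub>v v) \<bullet>c v"
    using p w psd_iff[OF bdiag_carrier[of a d R]] by metis
qed

lemma psd_cq_op_block:
  assumes "finite S" "\<And>s. s \<in> S \<Longrightarrow> \<rho> s \<in> carrier_mat d d" "psd (cq_op S d \<rho>)" "s \<in> S"
  shows "psd (\<rho> s)"
proof -
  have "from_nat_into S (to_nat_on S s) = s" using assms by (simp add: countable_finite)
  moreover have "to_nat_on S s < card S"
    using to_nat_on_finite[OF assms(1)] assms(4) by (auto simp: bij_betw_def)
  ultimately show ?thesis
    using psd_bdiag_block[of "card S" d "\<lambda>x. \<rho> (from_nat_into S x)" "to_nat_on S s"] assms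
    by (simp add: cq_op_eq_bdiag)
qed

lemma psd_msum:
  assumes "\<And>s. s \<in> S \<Longrightarrow> \<rho> s \<in> carrier_mat d d" "\<And>s. s \<in> S \<Longrightarrow> psd (\<rho> s)"
  shows "psd (msum d \<rho> S)"
  unfolding psd_iff[OF msum_carrier]
proof
  fix v :: "complex vec" assume v: "v \<in> carrier_vec d"
  have "(msum d \<rho> S *\<^sub>v v) \<bullet>c v = (\<Sum>i<d. \<Sum>j<d. \<Sum>s\<in>S. \<rho> s $$ (i, j) * v $ j * cnj (v $ i))"
    unfolding quadratic_form_sum[OF msum_carrier v v] by (simp add: msum_def sum_distrib_right)
  also have "\<dots> = (\<Sum>s\<in>S. \<Sum>i<d. \<Sum>j<d. \<rho> s $$ (i, j) * v $ j * cnj (v $ i))"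
    by (simp add: sum.swap[of _ S])
  also have "\<dots> = (\<Sum>s\<in>S. (\<rho> s *\<^sub>v v) \<bullet>c v)"
    using assms v by (intro sum.cong refl) (simp add: quadratic_form_sum[of _ d])
  also have "0 \<le> \<dots>" using assms v by (intro sum_nonneg) (simp add: psd_iff[of _ d])
  finally show "0 \<le> (msum d \<rho> S *\<^sub>v v) \<bullet>c v" .
qed

subsection \<open>The conditional entropy of a classical-quantum operator\<close>

text \<open>All blocks of the Kronecker product are equal, so square root and generalized inverse
  are taken blockwise. \<open>K\<close> is obtained before \<open>a\<close>: one \<open>K\<close>
  serves both the input and the output alphabet, whose sizes may differ.\<close>

lemma psd_inv_sqrt_kron:
  assumes A: "A \<in> carrier_mat d d" and p: "psd A"
  obtains K where "K \<in> carrier_mat d d"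
    "\<And>a. psd_inv_sqrt (kron (1\<^sub>m a) A) = bdiag a d (\<lambda>_. K * mat_adjoint K)"
proof -
  obtain U e where U: "unitary_mat d U" and e: "\<And>i. 0 \<le> e i" and Ae: "A = udiag d U e"
    using psd_spectral[OF A p] by blast
  \<comment> \<open>In terms of \<open>A\<close>: \<open>B\<close> is the square root,
    \<open>S\<close> the fourth root, \<open>X\<close> the generalized inverse of \<open>B\<close>,
    and \<open>K\<close> the square root of \<open>X\<close>. The factorization through
    \<open>S\<close> yields positivity of the block form of \<open>B\<close>.\<close>
  define S where "S = udiag d U (\<lambda>i. sqrt (sqrt (e i)))"
  define B where "B = udiag d U (\<lambda>i. sqrt (e i))"
  define K where "K = udiag d U (\<lambda>i. sqrt (inverse (sqrt (e i))))"
  define X where "X = udiag d U (\<lambda>i. inverse (sqrt (e i)))"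
  have c: "S \<in> carrier_mat d d" "B \<in> carrier_mat d d" "K \<in> carrier_mat d d" "X \<in> carrier_mat d d"
    using U by (simp_all add: S_def B_def K_def X_def)
  have SS: "S * mat_adjoint S = B" and BB: "B * B = A" and KK: "K * mat_adjoint K = X"
    using U e by (simp_all add: S_def B_def K_def X_def Ae udiag_mult real_sqrt_mult_self)
  \<comment> \<open>Since \<open>inverse 0 = 0\<close>, both identities also hold at 0, so
    \<open>X\<close> vanishes on the kernel of \<open>A\<close>, as a generalized inverse
    must.\<close>
  have inv: "inverse x * x * inverse x = inverse x" "x * inverse x * x = x" for x :: real
    by (cases "x = 0"; simp)+
  have pen: "B * X * B = B" "X * B * X = X"
    "mat_adjoint (B * X) = B * X" "mat_adjoint (X * B) = X * B"
    using U by (simp_all add: B_def X_def udiag_mult inv)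
  have "psd_inv_sqrt (kron (1\<^sub>m a) A) = bdiag a d (\<lambda>_. K * mat_adjoint K)" for a
  proof -
    let ?D = "\<lambda>Y. bdiag a d (\<lambda>_. Y)"
    have "?D S * mat_adjoint (?D S) = ?D B"
      using c by (simp add: bdiag_adjoint bdiag_mult SS)
    then have "psd (?D B)" using psd_mult_adjoint[OF bdiag_carrier] by metis
    moreover have "?D B * ?D B = ?D A" using c by (simp add: bdiag_mult BB)
    ultimately have "psd_sqrt (?D A) = ?D B" by (intro psd_sqrt_eqI[of _ "a * d"]) auto
    moreover have "penrose (?D B) (?D X)"
      unfolding penrose_def using c by (simp add: bdiag_mult bdiag_adjoint pen)
    then have "pseudo_inverse (?D B) = ?D X" by (intro pseudo_inverse_eqI[of _ "a * d"]) auto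
    ultimately show ?thesis by (simp add: psd_inv_sqrt_def kron_one_left[OF A] KK)
  qed
  then show ?thesis using that c(3) by blast
qed

section \<open>Trace formulas and the entropy as a sum of squared moduli\<close>

lemma mat_trace_mult_comm:
  assumes "A \<in> carrier_mat n n" "B \<in> carrier_mat n n"
  shows "mat_trace (A * B) = mat_trace (B * A)"
proof -
  have "mat_trace (A * B) = (\<Sum>i<n. \<Sum>j<n. A $$ (i, j) * B $$ (j, i))"
    using assms by (simp add: mat_trace_def scalar_prod_def atLeast0LessThan)
  also have "\<dots> = (\<Sum>j<n. \<Sum>i<n. B $$ (j, i) * A $$ (i, j))"
    by (subst sum.swap) (simp add: mult.commute)
  also have "\<dots> = mat_trace (B * A)"
    using assms by (simp add: mat_trace_def scalar_prod_def atLeast0LessThan)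
  finally show ?thesis .
qed

lemma mat_trace_mult_adjoint:
  assumes Y: "Y \<in> carrier_mat n n"
  shows "mat_trace (Y * mat_adjoint Y) = complex_of_real (\<Sum>i<n. \<Sum>j<n. (cmod (Y $$ (i, j)))\<^sup>2)"
  using Y by (simp add: mat_trace_def scalar_prod_def atLeast0LessThan complex_norm_square del: of_real_power)

text \<open>Cyclicity moves the last \<open>mat_adjoint K\<close> to the front, leaving the trace of
  the square of the Hermitian matrix \<open>mat_adjoint K * R * K\<close>, which is its squared
  Hilbert-Schmidt norm.\<close>

lemma mat_trace_sandwich:
  assumes R: "R \<in> carrier_mat n n" "mat_adjoint R = R" and K: "K \<in> carrier_mat n n"
  shows "mat_trace (R * (K * mat_adjoint K) * R * (K * mat_adjoint K))
    = complex_of_real (\<Sum>i<n. \<Sum>j<n. (cmod ((mat_adjoint K * R * K) $$ (i, j)))\<^sup>2)"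
proof -
  let ?Y = "mat_adjoint K * R * K"
  have "R * (K * mat_adjoint K) * R * (K * mat_adjoint K) = (R * (K * mat_adjoint K) * R * K) * mat_adjoint K"
    using R K by (simp add: assoc_mult_mat[of _ n n _ n _ n])
  then have "mat_trace (R * (K * mat_adjoint K) * R * (K * mat_adjoint K))
      = mat_trace (mat_adjoint K * (R * (K * mat_adjoint K) * R * K))"
    using R K by (simp add: mat_trace_mult_comm[of _ n])
  also have "mat_adjoint K * (R * (K * mat_adjoint K) * R * K) = ?Y * ?Y"
    using R K by (simp add: assoc_mult_mat[of _ n n _ n _ n])
  also have "?Y * ?Y = ?Y * mat_adjoint ?Y"
    using R K by (simp add: mat_adjoint_mult assoc_mult_mat[of _ n n _ n _ n])
  also have "mat_trace (?Y * mat_adjoint ?Y) = complex_of_real (\<Sum>i<n. \<Sum>j<n. (cmod (?Y $$ (i, j)))\<^sup>2)"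
    using R K by (intro mat_trace_mult_adjoint) simp
  finally show ?thesis .
qed

text \<open>All four factors under the trace are block diagonal, so it splits into one sandwich per
  label. \<open>K\<close> is a parameter tied only to the marginal, so that operators with equal
  marginals can share it.\<close>

lemma cond_renyi2_cq_op:
  assumes fin: "finite S" and \<rho>: "\<And>s. s \<in> S \<Longrightarrow> \<rho> s \<in> carrier_mat d d"
    and h: "\<And>s. s \<in> S \<Longrightarrow> mat_adjoint (\<rho> s) = \<rho> s"
    and K: "K \<in> carrier_mat d d"
      "psd_inv_sqrt (kron (1\<^sub>m (card S)) (msum d \<rho> S)) = bdiag (card S) d (\<lambda>_. K * mat_adjoint K)"
  shows "cond_renyi2 (card S) d (cq_op S d \<rho>)
    = - elog2 (\<Sum>s\<in>S. \<Sum>i<d. \<Sum>j<d. (cmod ((mat_adjoint K * \<rho> s * K) $$ (i, j)))\<^sup>2)"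
proof -
  let ?T = "K * mat_adjoint K"
  let ?r = "\<lambda>x. \<rho> (from_nat_into S x)"
  define G where "G s = (\<Sum>i<d. \<Sum>j<d. (cmod ((mat_adjoint K * \<rho> s * K) $$ (i, j)))\<^sup>2)" for s
  have T: "?T \<in> carrier_mat d d" using K by simp
  have r: "?r x \<in> carrier_mat d d" "mat_adjoint (?r x) = ?r x" if "x < card S" for x
    using \<rho> h from_nat_into_mem[OF that] by auto
  have D: "bdiag (card S) d ?r * bdiag (card S) d (\<lambda>_. ?T) * bdiag (card S) d ?r * bdiag (card S) d (\<lambda>_. ?T)
    = bdiag (card S) d (\<lambda>x. ?r x * ?T * ?r x * ?T)"
    using r T by (simp add: bdiag_mult)
  have pt: "ptrace1 (card S) d (cq_op S d \<rho>) = msum d \<rho> S"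
    by (rule ptrace1_cq_op[OF fin \<rho>])
  have "cond_renyi2 (card S) d (cq_op S d \<rho>) = - elog2 (Re (mat_trace
      (bdiag (card S) d ?r * bdiag (card S) d (\<lambda>_. ?T) * bdiag (card S) d ?r * bdiag (card S) d (\<lambda>_. ?T))))"
    unfolding cond_renyi2_def Let_def pt K(2) using fin \<rho> by (simp add: cq_op_eq_bdiag)
  also have "mat_trace (bdiag (card S) d ?r * bdiag (card S) d (\<lambda>_. ?T) * bdiag (card S) d ?r * bdiag (card S) d (\<lambda>_. ?T))
      = (\<Sum>x<card S. mat_trace (?r x * ?T * ?r x * ?T))"
    unfolding D using r T by (simp add: mat_trace_bdiag)
  also have "\<dots> = (\<Sum>x<card S. complex_of_real (G (from_nat_into S x)))"
    using r K(1) by (intro sum.cong refl) (simp add: mat_trace_sandwich[of _ d] G_def del: index_mult_mat)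
  also have "\<dots> = complex_of_real (sum G S)"
    by (simp add: sum_from_nat_into[OF fin, of "\<lambda>s. complex_of_real (G s)"])
  finally show ?thesis by (simp add: G_def)
qed

lemma mat_triple_index:
  fixes A B C :: "complex mat"
  assumes "A \<in> carrier_mat d d" "B \<in> carrier_mat d d" "C \<in> carrier_mat d d" "i < d" "j < d"
  shows "(A * B * C) $$ (i, j) = (\<Sum>k<d. \<Sum>l<d. A $$ (i, k) * (B $$ (k, l) * C $$ (l, j)))"
  using assms by (simp add: scalar_prod_def atLeast0LessThan sum_distrib_left)

text \<open>Linearity of the sandwich; with \<open>c\<close> equal to \<open>1 / of_nat D\<close>
  and \<open>S\<close> a fibre of \<open>f i\<close>, it expresses output entries by input
  entries.\<close>

lemma sandwich_msum_index:
  assumes "A \<in> carrier_mat d d" "C \<in> carrier_mat d d" "i < d" "j < d"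
    and "\<And>s. s \<in> S \<Longrightarrow> \<rho> s \<in> carrier_mat d d"
  shows "(A * (c \<cdot>\<^sub>m msum d \<rho> S) * C) $$ (i, j) = c * (\<Sum>s\<in>S. (A * \<rho> s * C) $$ (i, j))"
proof -
  have "(A * (c \<cdot>\<^sub>m msum d \<rho> S) * C) $$ (i, j)
      = (\<Sum>k<d. \<Sum>l<d. A $$ (i, k) * (c * (\<Sum>s\<in>S. \<rho> s $$ (k, l)) * C $$ (l, j)))"
    using assms(1-4) by (subst mat_triple_index[of _ d]) (simp_all add: msum_def)
  also have "\<dots> = (\<Sum>k<d. \<Sum>l<d. \<Sum>s\<in>S. c * (A $$ (i, k) * (\<rho> s $$ (k, l) * C $$ (l, j))))"
    by (simp add: sum_distrib_left sum_distrib_right mult_ac)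
  also have "\<dots> = (\<Sum>s\<in>S. \<Sum>k<d. \<Sum>l<d. c * (A $$ (i, k) * (\<rho> s $$ (k, l) * C $$ (l, j))))"
    by (simp add: sum.swap[of _ S])
  also have "\<dots> = c * (\<Sum>s\<in>S. (A * \<rho> s * C) $$ (i, j))"
    using assms by (simp add: mat_triple_index[of _ d] sum_distrib_left del: index_mult_mat)
  finally show ?thesis .
qed

subsection \<open>Extractors\<close>

text \<open>Trades entropy bounds for bounds on the sums under the logarithm. For
  \<open>x \<le> 0\<close> both sides hold: the entropy is infinite, and the power is
  non-negative.\<close>

lemma le_uminus_elog2_iff:
  "ereal k \<le> - elog2 x \<longleftrightarrow> x \<le> 2 powr (- k)"
proof (cases "x > 0")
  case True
  then have "ereal k \<le> - elog2 x \<longleftrightarrow> log 2 x \<le> - k" by (auto simp: elog2_def)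
  also have "\<dots> \<longleftrightarrow> x \<le> 2 powr (- k)" using True by (subst log_le_iff) auto
  finally show ?thesis .
next
  case False
  then have "x \<le> 2 powr (- k)" by (meson linorder_not_less order_trans powr_ge_zero)
  then show ?thesis using False by (simp add: elog2_def)
qed

text \<open>The fibres of \<open>f\<close> over \<open>M\<close> partition \<open>N\<close>.\<close>

lemma sum_ext_blocks:
  fixes g :: "'a \<Rightarrow> 'c::comm_monoid_add"
  assumes "finite N" "finite M" "f \<in> N \<rightarrow> M"
  shows "(\<Sum>m\<in>M. \<Sum>n | n \<in> N \<and> f n = m. g n) = sum g N"
  using assms by (intro sum.group) auto

text \<open>The extractor property is only assumed for functions of norm at most \<open>2 powr (- k / 2)\<close>;
  as the inequality is homogeneous, it extends to all non-negative functions.\<close>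

lemma extractor_quadratic_bound:
  assumes ext: "strong_renyi2_extractor N M D f k \<epsilon>"
    and fin: "finite N" and M: "0 < card M" and D: "1 \<le> D" and \<epsilon>: "0 < \<epsilon>"
    and P: "\<And>n. n \<in> N \<Longrightarrow> 0 \<le> P n"
  shows "(\<Sum>x\<in>M \<times> {1..D}. (ext_output N D f P x)\<^sup>2)
    \<le> (2 powr k * ((\<epsilon> + 1) / (real (card M) * real D))) * (\<Sum>n\<in>N. (P n)\<^sup>2)"
proof -
  let ?L = "real (card M) * real D / (\<epsilon> + 1)"
  have Lpos: "?L > 0" using M D \<epsilon> by simp
  have L: "2 powr (- log 2 ?L) = (\<epsilon> + 1) / (real (card M) * real D)"
    using Lpos by (simp add: powr_minus inverse_eq_divide)
  define s where "s = (\<Sum>n\<in>N. (P n)\<^sup>2)"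
  have s0: "0 \<le> s" by (simp add: s_def sum_nonneg)
  show ?thesis
  proof (cases "s = 0")
    \<comment> \<open>Rescaling is impossible here, but \<open>P\<close> vanishes on
      \<open>N\<close> and both sides are 0.\<close>
    case True
    then have "P n = 0" if "n \<in> N" for n
      using that fin by (simp add: s_def sum_nonneg_eq_0_iff)
    then have "ext_output N D f P x = 0" for x
      by (auto simp: ext_output_def split_beta intro!: sum.neutral)
    then show ?thesis using True by (simp add: s_def)
  next
    case False
    then have s: "s > 0" using s0 by simp
    \<comment> \<open>Chosen so that \<open>c * P n\<close> has squared norm exactly
      \<open>2 powr (- k)\<close>, the largest that entropy at least \<open>k\<close>
      allows.\<close>
    define c where "c = sqrt (2 powr (- k) / s)"
    have c0: "0 < c" and c2: "c\<^sup>2 = 2 powr (- k) / s" using s by (simp_all add: c_def)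
    have "(\<Sum>n\<in>N. (c * P n)\<^sup>2) = c\<^sup>2 * s"
      by (simp add: s_def power_mult_distrib sum_distrib_left)
    also have "\<dots> = 2 powr (- k)" using s by (simp add: c2)
    finally have "renyi2 N (\<lambda>n. c * P n) \<ge> ereal k"
      by (simp add: renyi2_def le_uminus_elog2_iff)
    then have "renyi2 (M \<times> {1..D}) (ext_output N D f (\<lambda>n. c * P n)) \<ge> ereal (log 2 ?L)"
      using ext P c0 by (auto simp: strong_renyi2_extractor_def)
    then have *: "(\<Sum>x\<in>M \<times> {1..D}. (ext_output N D f (\<lambda>n. c * P n) x)\<^sup>2)
        \<le> (\<epsilon> + 1) / (real (card M) * real D)"
      unfolding renyi2_def le_uminus_elog2_iff L .
    have "ext_output N D f (\<lambda>n. c * P n) x = c * ext_output N D f P x" for x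
      by (simp add: ext_output_def split_beta sum_distrib_left)
    then have "(\<Sum>x\<in>M \<times> {1..D}. (ext_output N D f (\<lambda>n. c * P n) x)\<^sup>2)
        = c\<^sup>2 * (\<Sum>x\<in>M \<times> {1..D}. (ext_output N D f P x)\<^sup>2)"
      by (simp add: power_mult_distrib sum_distrib_left)
    with * have "2 powr (- k) / s * (\<Sum>x\<in>M \<times> {1..D}. (ext_output N D f P x)\<^sup>2)
        \<le> (\<epsilon> + 1) / (real (card M) * real D)"
      by (simp add: c2)
    then show ?thesis
      unfolding s_def[symmetric] using s by (simp add: powr_minus field_simps)
  qed
qed

text \<open>The triangle inequality within each fibre bounds the output of \<open>g\<close> by the
  output of its modulus, to which the non-negative case applies.\<close>

lemma extractor_complex_bound:
  fixes g :: "'a \<Rightarrow> complex"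
  assumes ext: "strong_renyi2_extractor N M D f k \<epsilon>"
    and fin: "finite N" and M: "0 < card M" and D: "1 \<le> D" and \<epsilon>: "0 < \<epsilon>"
  shows "(\<Sum>(m, i)\<in>M \<times> {1..D}. (cmod ((1 / of_nat D) * (\<Sum>n | n \<in> N \<and> f i n = m. g n)))\<^sup>2)
    \<le> (2 powr k * ((\<epsilon> + 1) / (real (card M) * real D))) * (\<Sum>n\<in>N. (cmod (g n))\<^sup>2)"
proof -
  have "(\<Sum>(m, i)\<in>M \<times> {1..D}. (cmod ((1 / of_nat D) * (\<Sum>n | n \<in> N \<and> f i n = m. g n)))\<^sup>2)
    \<le> (\<Sum>x\<in>M \<times> {1..D}. (ext_output N D f (\<lambda>n. cmod (g n)) x)\<^sup>2)"
    unfolding ext_output_def split_beta norm_mult norm_divide norm_of_nat norm_one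
    by (intro sum_mono power_mono mult_left_mono norm_sum) auto
  also have "\<dots> \<le> (2 powr k * ((\<epsilon> + 1) / (real (card M) * real D))) * (\<Sum>n\<in>N. (cmod (g n))\<^sup>2)"
    by (rule extractor_quadratic_bound[OF assms]) simp
  finally show ?thesis .
qed

text \<open>For each seed, summing over the fibres recovers the full sum over \<open>N\<close>, and
  averaging \<open>D \<ge> 1\<close> equal terms changes nothing. Hence input and output have the
  same marginal on the side information.\<close>

lemma msum_ext_output_qsi:
  assumes fin: "finite N" "finite M" and D: "1 \<le> D" and f: "\<And>i. i \<in> {1..D} \<Longrightarrow> f i \<in> N \<rightarrow> M"
  shows "msum d (ext_output_qsi N D f d \<rho>) (M \<times> {1..D}) = msum d \<rho> N"
proof (rule eq_matI)
  fix a b assume "a < dim_row (msum d \<rho> N)" "b < dim_col (msum d \<rho> N)"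
  then have ab: "a < d" "b < d" by (simp_all add: msum_def)
  have "msum d (ext_output_qsi N D f d \<rho>) (M \<times> {1..D}) $$ (a, b)
      = (\<Sum>(m, i)\<in>M \<times> {1..D}. (1 / of_nat D) * (\<Sum>n | n \<in> N \<and> f i n = m. \<rho> n $$ (a, b)))"
    using ab by (simp add: msum_def ext_output_qsi_def split_beta)
  also have "\<dots> = (\<Sum>i = 1..D. (1 / of_nat D) * (\<Sum>m\<in>M. \<Sum>n | n \<in> N \<and> f i n = m. \<rho> n $$ (a, b)))"
    by (simp add: sum.cartesian_product[symmetric] sum.swap[of _ M] sum_distrib_left)
  also have "\<dots> = (\<Sum>i = 1..D. (1 / of_nat D) * (\<Sum>n\<in>N. \<rho> n $$ (a, b)))"
    using fin f by (intro sum.cong refl) (simp only: sum_ext_blocks)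
  also have "\<dots> = (\<Sum>n\<in>N. \<rho> n $$ (a, b))" using D by simp
  finally show "msum d (ext_output_qsi N D f d \<rho>) (M \<times> {1..D}) $$ (a, b) = msum d \<rho> N $$ (a, b)"
    using ab by (simp add: msum_def)
qed (simp_all add: msum_def)

theorem theorem4p11:
  fixes N M :: "'a set" and k \<epsilon> :: real and D :: nat and f :: "nat \<Rightarrow> 'a \<Rightarrow> 'a"
  assumes "finite N" and "N \<noteq> {}" and "M \<subseteq> N"
    and "0 \<le> k" and "k \<le> log 2 (real (card N))"
    and "0 < \<epsilon>"
    and "1 \<le> D"
    and "\<And>i. i \<in> {1..D} \<Longrightarrow> f i \<in> N \<rightarrow> M"
    and "strong_renyi2_extractor N M D f k \<epsilon>"
  shows "strong_renyi2_extractor_qsi N M D f k \<epsilon>"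
  unfolding strong_renyi2_extractor_qsi_def
proof (intro allI impI)
  fix d :: nat and \<rho> :: "'a \<Rightarrow> complex mat"
  assume c: "\<forall>n\<in>N. \<rho> n \<in> carrier_mat d d" and p: "psd (cq_op N d \<rho>)"
    and H: "cond_renyi2 (card N) d (cq_op N d \<rho>) \<ge> ereal k"
  have finM: "finite M" using assms(1,3) finite_subset by blast
  \<comment> \<open>The seed 1 exists, and \<open>f 1\<close> maps the non-empty \<open>N\<close>
    into \<open>M\<close>.\<close>
  have "M \<noteq> {}" using assms(2,7) assms(8)[of 1] by auto
  then have M: "0 < card M" using finM by (simp add: card_gt_0_iff)
  have \<rho>c: "\<rho> n \<in> carrier_mat d d" if "n \<in> N" for n using c that by blast
  have \<rho>p: "psd (\<rho> n)" if "n \<in> N" for n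
    by (rule psd_cq_op_block[OF assms(1) \<rho>c p that])
  have \<rho>h: "mat_adjoint (\<rho> n) = \<rho> n" if "n \<in> N" for n
    by (rule psd_hermitian[OF \<rho>c[OF that] \<rho>p[OF that]])
  have "psd (msum d \<rho> N)" by (rule psd_msum[OF \<rho>c \<rho>p])
  then obtain K where K: "K \<in> carrier_mat d d"
    "\<And>a. psd_inv_sqrt (kron (1\<^sub>m a) (msum d \<rho> N)) = bdiag a d (\<lambda>_. K * mat_adjoint K)"
    using psd_inv_sqrt_kron[OF msum_carrier] by blast
  define Y where "Y n i j = (mat_adjoint K * \<rho> n * K) $$ (i, j)" for n i j
  let ?c = "2 powr k * ((\<epsilon> + 1) / (real (card M) * real D))"
  let ?\<sigma> = "ext_output_qsi N D f d \<rho>"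
  have "cond_renyi2 (card N) d (cq_op N d \<rho>) = - elog2 (\<Sum>n\<in>N. \<Sum>a<d. \<Sum>b<d. (cmod (Y n a b))\<^sup>2)"
    unfolding Y_def by (rule cond_renyi2_cq_op[OF assms(1) \<rho>c \<rho>h K])
  with H have Nbound: "(\<Sum>n\<in>N. \<Sum>a<d. \<Sum>b<d. (cmod (Y n a b))\<^sup>2) \<le> 2 powr (- k)"
    by (simp add: le_uminus_elog2_iff)
  have \<sigma>c: "?\<sigma> x \<in> carrier_mat d d" for x
    by (simp add: ext_output_qsi_def split_beta)
  \<comment> \<open>The factor \<open>1 / of_nat D\<close> is real, so Hermiticity passes entrywise
    from the inputs.\<close>
  have \<sigma>h: "mat_adjoint (?\<sigma> x) = ?\<sigma> x" for x
  proof (rule eq_matI)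
    fix a b assume "a < dim_row (?\<sigma> x)" "b < dim_col (?\<sigma> x)"
    then have ab: "a < d" "b < d" using \<sigma>c[of x] by auto
    have "cnj (\<rho> n $$ (b, a)) = \<rho> n $$ (a, b)" if "n \<in> N" for n
      using arg_cong[OF \<rho>h[OF that], of "\<lambda>X. X $$ (a, b)"] \<rho>c[OF that] ab by simp
    then show "mat_adjoint (?\<sigma> x) $$ (a, b) = ?\<sigma> x $$ (a, b)"
      using ab by (simp add: ext_output_qsi_def split_beta msum_def)
  qed (use \<sigma>c[of x] in auto)
  have \<sigma>sum: "msum d ?\<sigma> (M \<times> {1..D}) = msum d \<rho> N"
    by (rule msum_ext_output_qsi[OF assms(1) finM assms(7,8)])
  have "cond_renyi2 (card (M \<times> {1..D})) d (cq_op (M \<times> {1..D}) d ?\<sigma>)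
    = - elog2 (\<Sum>x\<in>M \<times> {1..D}. \<Sum>a<d. \<Sum>b<d. (cmod ((mat_adjoint K * ?\<sigma> x * K) $$ (a, b)))\<^sup>2)"
  proof (rule cond_renyi2_cq_op[OF _ \<sigma>c \<sigma>h K(1)])
    show "finite (M \<times> {1..D})" using finM by simp
    show "psd_inv_sqrt (kron (1\<^sub>m (card (M \<times> {1..D}))) (msum d ?\<sigma> (M \<times> {1..D})))
        = bdiag (card (M \<times> {1..D})) d (\<lambda>_. K * mat_adjoint K)"
      unfolding \<sigma>sum by (rule K(2))
  qed
  moreover have "(\<Sum>x\<in>M \<times> {1..D}. \<Sum>a<d. \<Sum>b<d. (cmod ((mat_adjoint K * ?\<sigma> x * K) $$ (a, b)))\<^sup>2)
      \<le> (\<epsilon> + 1) / (real (card M) * real D)"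
  proof -
    have "(\<Sum>x\<in>M \<times> {1..D}. \<Sum>a<d. \<Sum>b<d. (cmod ((mat_adjoint K * ?\<sigma> x * K) $$ (a, b)))\<^sup>2)
      = (\<Sum>(m, i)\<in>M \<times> {1..D}. \<Sum>a<d. \<Sum>b<d. (cmod ((1 / of_nat D) * (\<Sum>n | n \<in> N \<and> f i n = m. Y n a b)))\<^sup>2)"
      unfolding ext_output_qsi_def split_beta Y_def
      using K(1) \<rho>c by (intro sum.cong refl) (subst sandwich_msum_index, auto)
    also have "\<dots> = (\<Sum>a<d. \<Sum>b<d. \<Sum>(m, i)\<in>M \<times> {1..D}. (cmod ((1 / of_nat D) * (\<Sum>n | n \<in> N \<and> f i n = m. Y n a b)))\<^sup>2)"
      unfolding split_beta by (simp only: sum.swap[of _ "M \<times> {1..D}"])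
    \<comment> \<open>For each fixed pair \<open>a\<close>, \<open>b\<close> the classical bound is
      applied to the complex function sending \<open>n\<close> to \<open>Y n a b\<close>.\<close>
    also have "\<dots> \<le> (\<Sum>a<d. \<Sum>b<d. ?c * (\<Sum>n\<in>N. (cmod (Y n a b))\<^sup>2))"
      by (intro sum_mono extractor_complex_bound[OF assms(9,1) M assms(7,6)])
    also have "\<dots> = ?c * (\<Sum>n\<in>N. \<Sum>a<d. \<Sum>b<d. (cmod (Y n a b))\<^sup>2)"
      by (simp only: sum_distrib_left sum.swap[of _ N])
    \<comment> \<open>The entropy hypothesis on the input enters here; the factor
      \<open>2 powr k\<close> in \<open>?c\<close> then cancels.\<close>
    also have "\<dots> \<le> ?c * 2 powr (- k)"
      using Nbound assms(6) by (intro mult_left_mono) auto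
    also have "\<dots> = (\<epsilon> + 1) / (real (card M) * real D)" by (simp add: powr_minus)
    finally show ?thesis .
  qed
  moreover have "2 powr (- log 2 (real (card M) * real D / (\<epsilon> + 1))) = (\<epsilon> + 1) / (real (card M) * real D)"
    using M assms(6,7) by (simp add: powr_minus)
  ultimately show "cond_renyi2 (card (M \<times> {1..D})) d (cq_op (M \<times> {1..D}) d ?\<sigma>)
      \<ge> ereal (log 2 (real (card M) * real D / (\<epsilon> + 1)))"
    by (simp only: le_uminus_elog2_iff)
qed

end
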